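(* Let $X$ be a Banach space, let $T : X \to X^*$ be a dual map, and let $x \in X \setminus \{0\}$. The following conditions are equivalent: (1) $T$ is $\|\cdot\|$-$w^*$ continuous at $x$. (2) $\frac{x}{\|x\|}$ is a smooth point of the closed unit ball $\mathsf{B}_X$, i.e. $\frac{x}{\|x\|} \in \mathrm{smo}(\mathsf{B}_X)$.
   Context: Banach spaces are over $\mathbb{R}$ or $\mathbb{C}$; $\mathsf{B}_X$ and $\mathsf{S}_X$ denote the closed unit ball and the unit sphere of $X$, and $X^*$ is the (continuous) dual. A map $T : X \to X^*$ (not assumed linear, homogeneous or continuous) is called a dual map if $\|T(x)\| = \|x\|$ and $T(x)(x) = \|x\|^2$ for all $x \in X$. A point $x \in \mathsf{S}_X$ is a smooth point of $\mathsf{B}_X$ if there is exactly one $f \in \mathsf{S}_{X^*}$ attaining its norm at $x$, i.e. with $f(x) = 1$. The set of smooth points of $\mathsf{B}_X$ is denoted $\mathrm{smo}(\mathsf{B}_X)$. "$\|\cdot\|$-$w^*$ continuous at $x$" means continuous at $x$ as a map from $X$ with the norm topology to $X^*$ with the weak-star topology. *)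

theory Defs
  imports "HOL-Analysis.Analysis"
begin

(* The scalar fields are exactly the real_normed_fields that are isometrically isomorphic
   to the reals or to the complex numbers; in particular real and complex are instances. *)
class real_or_complex = real_normed_field +
  assumes real_or_complex:
    "(\<exists>h :: 'a \<Rightarrow> real. bij h \<and> (\<forall>z w. h (z + w) = h z + h w) \<and> (\<forall>r z. h (r *\<^sub>R z) = r *\<^sub>R h z) \<and>
        (\<forall>z w. h (z * w) = h z * h w) \<and> (\<forall>z. norm (h z) = norm z)) \<or>
     (\<exists>h :: 'a \<Rightarrow> complex. bij h \<and> (\<forall>z w. h (z + w) = h z + h w) \<and> (\<forall>r z. h (r *\<^sub>R z) = r *\<^sub>R h z) \<and>
        (\<forall>z w. h (z * w) = h z * h w) \<and> (\<forall>z. norm (h z) = norm z))"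

instance real :: real_or_complex
  by standard (intro disjI1 exI[of _ "\<lambda>x. x"], auto simp: bij_def)

instance complex :: real_or_complex
  by standard (intro disjI2 exI[of _ "\<lambda>x. x"], auto simp: bij_def)

(* The class banach supplies the norm, its completeness and the underlying real structure;
   smul is the multiplication by scalars from 'k, which extends the real one. *)
locale banach_space_over = vector_space smul
  for smul :: "'k::real_or_complex \<Rightarrow> 'a::banach \<Rightarrow> 'a" +
  assumes smul_of_real: "smul (of_real r) x = r *\<^sub>R x"
    and norm_smul: "norm (smul c x) = norm c * norm x"

lemma banach_space_over_real: "banach_space_over (scaleR :: real \<Rightarrow> 'a::banach \<Rightarrow> 'a)"
  by unfold_locales (simp_all add: scaleR_add_right scaleR_add_left)

lemma banach_space_over_complex: "banach_space_over ((*) :: complex \<Rightarrow> complex \<Rightarrow> complex)"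
  by unfold_locales (simp_all add: algebra_simps norm_mult scaleR_conv_of_real)

(* The type of bounded real-linear maps carries the operator norm; the dual consists of those
   that are linear over 'k. *)
definition dual_space :: "('k::real_or_complex \<Rightarrow> 'a::banach \<Rightarrow> 'a) \<Rightarrow> ('a \<Rightarrow>\<^sub>L 'k) set" where
  "dual_space smul = {f. \<forall>c x. blinfun_apply f (smul c x) = c * blinfun_apply f x}"

(* The topology of pointwise convergence on the dual. *)
definition weak_star_topology ::
    "('k::real_or_complex \<Rightarrow> 'a::banach \<Rightarrow> 'a) \<Rightarrow> ('a \<Rightarrow>\<^sub>L 'k) topology" where
  "weak_star_topology smul =
     pullback_topology (dual_space smul) blinfun_apply (product_topology (\<lambda>_. euclidean) UNIV)"

definition dual_map ::
    "('k::real_or_complex \<Rightarrow> 'a::banach \<Rightarrow> 'a) \<Rightarrow> ('a \<Rightarrow> 'a \<Rightarrow>\<^sub>L 'k) \<Rightarrow> bool" where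
  "dual_map smul T \<longleftrightarrow>
     (\<forall>x. T x \<in> dual_space smul \<and> norm (T x) = norm x \<and>
          blinfun_apply (T x) x = of_real ((norm x)\<^sup>2))"

definition smooth_points :: "('k::real_or_complex \<Rightarrow> 'a::banach \<Rightarrow> 'a) \<Rightarrow> 'a set" where
  "smooth_points smul =
     {x \<in> sphere 0 1. \<exists>!f. f \<in> dual_space smul \<and> norm f = 1 \<and> blinfun_apply f x = 1}"

end

theory Submission
  imports Defs
begin

text \<open>
  Let \<open>J(x)\<close> be the set of functionals \<open>f\<close> with \<open>\<parallel>f\<parallel> = \<parallel>x\<parallel>\<close> and \<open>f(x) = \<parallel>x\<parallel>\<^sup>2\<close>. A dual map is a
  selection of the set-valued map \<open>J\<close>, and rescaling shows that \<open>x/\<parallel>x\<parallel>\<close> is smooth if and only if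
  \<open>J(x)\<close> is a singleton. The theorem thus says that a selection \<open>T\<close> of \<open>J\<close> is continuous at \<open>x\<close>
  exactly when it had no choice there. It rests on two properties of \<open>J\<close>.

  Monotonicity (\<open>duality_set_monotone\<close>): the real part of \<open>(f - g)(x - u)\<close> is nonnegative for
  \<open>f \<in> J(x)\<close> and \<open>g \<in> J(u)\<close>. If \<open>T\<close> is continuous at \<open>x\<close> and \<open>f \<in> J(x)\<close>, take \<open>g = T(u)\<close> with
  \<open>u = x + t y\<close>, divide by \<open>t\<close> and let \<open>t\<close> decrease to \<open>0\<close>: the real part of \<open>(f - T(x))(y)\<close> is
  at most \<open>0\<close> for every \<open>y\<close>. A scalar-linear functional with this property vanishes, so
  \<open>f = T(x)\<close>. This is Minty's argument for maximal monotone operators.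

  Closedness (\<open>duality_set_limit\<close>): if \<open>T(u)\<close> converges pointwise as \<open>u\<close> tends to \<open>x\<close> along some
  filter, then the limit belongs to \<open>J(x)\<close>. If \<open>T\<close> were not continuous at \<open>x\<close>, it would stay, along
  some filter converging to \<open>x\<close>, outside a neighbourhood of \<open>T(x)\<close>. Since \<open>T\<close> is bounded near
  \<open>x\<close>, Tychonoff's theorem gives a finer filter along which \<open>T(u)\<close> converges pointwise. The limit
  is an element of \<open>J(x)\<close> other than \<open>T(x)\<close>, so \<open>J(x)\<close> is not a singleton.
\<close>

section \<open>The scalar field\<close>

text \<open>
  The three properties below are all that the monotonicity argument uses of the real part, so
  that it treats both scalar fields at once.
\<close>

lemma scalar_real_part:
  obtains re :: "'k::real_or_complex \<Rightarrow> real"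
  where "bounded_linear re" "re 1 = 1" "\<And>z. \<bar>re z\<bar> \<le> norm z"
proof -
  consider
    (real) h :: "'k \<Rightarrow> real" where "bij h" "\<forall>z w. h (z + w) = h z + h w"
      "\<forall>r z. h (r *\<^sub>R z) = r *\<^sub>R h z" "\<forall>z w. h (z * w) = h z * h w" "\<forall>z. norm (h z) = norm z"
  | (complex) h :: "'k \<Rightarrow> complex" where "bij h" "\<forall>z w. h (z + w) = h z + h w"
      "\<forall>r z. h (r *\<^sub>R z) = r *\<^sub>R h z" "\<forall>z w. h (z * w) = h z * h w" "\<forall>z. norm (h z) = norm z"
    using real_or_complex[where 'a = 'k] by blast
  then show thesis
  proof cases
    case real
    have "h 1 * h 1 = h 1" "norm (h 1) = 1"
      using real(4)[rule_format, of 1 1] real(5) by simp_all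
    then have "h 1 = 1" by auto
    moreover have "bounded_linear h"
      by (rule bounded_linear_intro[where K = 1]) (use real in auto)
    ultimately show thesis
      using that[of h] real(5) by auto
  next
    case complex
    have "h 1 * h 1 = h 1" "norm (h 1) = 1"
      using complex(4)[rule_format, of 1 1] complex(5) by simp_all
    then have "h 1 = 1" by auto
    moreover have "bounded_linear h"
      by (rule bounded_linear_intro[where K = 1]) (use complex in auto)
    then have "bounded_linear (\<lambda>z. Re (h z))"
      by (rule bounded_linear_compose[OF bounded_linear_Re])
    ultimately show thesis
      using that[of "\<lambda>z. Re (h z)"] complex(5) abs_Re_le_cmod by (metis one_complex.sel(1))
  qed
qed

text \<open>
  Compactness of the balls of the scalar field is what Tychonoff's theorem is applied to; here it
  is carried over from the real or complex numbers along the given isometry.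
\<close>

lemma compact_cball_transfer:
  fixes h :: "'b::real_normed_vector \<Rightarrow> 'c::{real_normed_vector, heine_borel}"
  assumes "bij h" "\<And>z w. h (z + w) = h z + h w" "\<And>z. norm (h z) = norm z"
  shows "compact (cball (0::'b) r)"
proof -
  interpret h: additive h by standard (rule assms(2))
  have h_inv: "h (inv h c) = c" for c
    using assms(1) by (simp add: bij_is_surj surj_f_inv_f)
  have inv_h: "inv h (h z) = z" for z
    using assms(1) by (simp add: bij_is_inj inv_f_f)
  have isometric: "dist (inv h c) (inv h d) = dist c d" for c d
    by (metis assms(3) dist_norm h.diff h_inv)
  have "continuous_on (cball 0 r) (inv h)"
    unfolding continuous_on_iff isometric by blast
  moreover have "cball 0 r = inv h ` cball 0 r"
  proof (intro equalityI subsetI)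
    fix z assume "z \<in> cball (0::'b) r"
    then have "h z \<in> cball 0 r" by (simp add: assms(3))
    then show "z \<in> inv h ` cball 0 r" using inv_h by (metis image_eqI)
  next
    fix z assume "z \<in> inv h ` cball 0 r"
    then show "z \<in> cball 0 r" using assms(3) h_inv by (auto simp flip: assms(3))
  qed
  ultimately show ?thesis
    by (metis compact_cball compact_continuous_image)
qed

lemma scalar_compact_cball: "compact (cball (0::'k::real_or_complex) r)"
  using real_or_complex[where 'a = 'k] by (elim disjE exE conjE; intro compact_cball_transfer) auto

section \<open>Weak-star continuity\<close>

lemma tendsto_fun_iff:
  fixes f :: "'b \<Rightarrow> 'i \<Rightarrow> 'c::topological_space"
  shows "(f \<longlongrightarrow> g) F \<longleftrightarrow> (\<forall>i. ((\<lambda>u. f u i) \<longlongrightarrow> g i) F)"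
  using limitin_componentwise[of "\<lambda>_. euclidean" UNIV f g F]
  by (simp add: euclidean_product_topology)

text \<open>
  The neighbourhood filter \<open>nhds x\<close> includes the point \<open>x\<close> itself, which matches the neighbourhoods in
  \<open>topcontinuous_at\<close>.
\<close>

lemma topcontinuous_at_weak_star_iff:
  fixes T :: "'a::banach \<Rightarrow> 'a \<Rightarrow>\<^sub>L 'k::real_or_complex"
  assumes "\<And>u. T u \<in> dual_space smul"
  shows "topcontinuous_at euclidean (weak_star_topology smul) T x \<longleftrightarrow>
         (\<forall>y. ((\<lambda>u. T u y) \<longlongrightarrow> T x y) (nhds x))"
proof -
  have "topcontinuous_at euclidean (weak_star_topology smul) T x \<longleftrightarrow>
        ((\<lambda>u. blinfun_apply (T u)) \<longlongrightarrow> blinfun_apply (T x)) (nhds x)"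
  proof -
    have "openin (weak_star_topology smul) V \<longleftrightarrow>
        (\<exists>W. open W \<and> V = blinfun_apply -` W \<inter> dual_space smul)" for V
      by (simp add: weak_star_topology_def openin_pullback_topology euclidean_product_topology)
    then have "(\<forall>V. openin (weak_star_topology smul) V \<and> T x \<in> V \<longrightarrow> P V) \<longleftrightarrow>
        (\<forall>W. open W \<longrightarrow> blinfun_apply (T x) \<in> W \<longrightarrow> P (blinfun_apply -` W \<inter> dual_space smul))" for P
      using assms[of x] by (metis IntE IntI vimageE vimageI)
    moreover have "topspace (weak_star_topology smul) = dual_space smul"
      by (simp add: weak_star_topology_def topspace_pullback_topology euclidean_product_topology)
    ultimately show ?thesis
      using assms by (simp add: topcontinuous_at_def tendsto_def eventually_nhds)
  qed
  then show ?thesis by (simp add: tendsto_fun_iff)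
qed

text \<open>
  The filter form of passing to a convergent subnet. The finer filter lives on the domain of \<open>\<Phi>\<close>,
  and not on its values, so that convergence of the argument \<open>u\<close> itself is kept: a limit of
  functionals \<open>T(u)\<close> can then be compared with quantities such as \<open>\<parallel>u\<parallel>\<close>.
\<close>

lemma compact_convergent_subfilter:
  assumes "compact K" "F \<noteq> bot" "eventually (\<lambda>u. \<Phi> u \<in> K) F"
  obtains g G where "G \<le> F" "G \<noteq> bot" "(\<Phi> \<longlongrightarrow> g) G"
proof -
  have "filtermap \<Phi> F \<noteq> bot" "eventually (\<lambda>p. p \<in> K) (filtermap \<Phi> F)"
    using assms(2,3) by (simp_all add: filtermap_bot_iff eventually_filtermap)
  then obtain g where g: "inf (nhds g) (filtermap \<Phi> F) \<noteq> bot"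
    using assms(1) unfolding compact_filter by blast
  define G where "G = inf F (filtercomap \<Phi> (nhds g))"
  have "G \<noteq> bot"
  proof
    assume "G = bot"
    then obtain P Q where PQ: "eventually P F" "eventually Q (nhds g)" "\<And>u. P u \<Longrightarrow> Q (\<Phi> u) \<Longrightarrow> False"
      unfolding G_def trivial_limit_def eventually_inf eventually_filtercomap by blast
    have "eventually (\<lambda>p. \<not> Q p) (filtermap \<Phi> F)"
      unfolding eventually_filtermap using PQ(1) by (rule eventually_mono) (use PQ(3) in blast)
    with PQ(2) g show False
      unfolding trivial_limit_def eventually_inf by blast
  qed
  moreover have "(\<Phi> \<longlongrightarrow> g) G"
    unfolding G_def using filterlim_filtercomap by (rule filterlim_mono) auto
  ultimately show thesis using that[of G g] by (simp add: G_def)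
qed

section \<open>The duality mapping\<close>

definition duality_set :: "('k::real_or_complex \<Rightarrow> 'a::banach \<Rightarrow> 'a) \<Rightarrow> 'a \<Rightarrow> ('a \<Rightarrow>\<^sub>L 'k) set" where
  "duality_set smul x =
     {f \<in> dual_space smul. norm f = norm x \<and> blinfun_apply f x = of_real ((norm x)\<^sup>2)}"

lemma dual_map_iff_duality_set: "dual_map smul T \<longleftrightarrow> (\<forall>x. T x \<in> duality_set smul x)"
  by (simp add: dual_map_def duality_set_def)

lemma scaleR_in_dual_space: "f \<in> dual_space smul \<Longrightarrow> r *\<^sub>R f \<in> dual_space smul"
  by (simp add: dual_space_def blinfun.scaleR_left)

text \<open>
  Multiplication by \<open>\<parallel>x\<parallel>\<close> is a bijection from the functionals of norm one that attain their norm at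
  \<open>x/\<parallel>x\<parallel>\<close> onto the duality set.
\<close>

lemma smooth_point_iff_duality_set_singleton:
  fixes smul :: "'k::real_or_complex \<Rightarrow> 'a::banach \<Rightarrow> 'a"
  assumes "x \<noteq> 0"
  shows "x /\<^sub>R norm x \<in> smooth_points smul \<longleftrightarrow> (\<exists>!f. f \<in> duality_set smul x)"
proof -
  let ?S = "{f \<in> dual_space smul. norm f = 1 \<and> blinfun_apply f (x /\<^sub>R norm x) = 1}"
  have "bij_betw ((*\<^sub>R) (norm x)) ?S (duality_set smul x)"
  proof (rule bij_betw_byWitness[where f' = "(*\<^sub>R) (inverse (norm x))"])
    show "(*\<^sub>R) (norm x) ` ?S \<subseteq> duality_set smul x"
    proof (intro image_subsetI)
      fix f assume f: "f \<in> ?S"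
      have "blinfun_apply f x = norm x *\<^sub>R blinfun_apply f (x /\<^sub>R norm x)"
        using assms by (simp add: blinfun.scaleR_right)
      with f show "norm x *\<^sub>R f \<in> duality_set smul x"
        by (simp add: duality_set_def scaleR_in_dual_space blinfun.scaleR_left
            scaleR_conv_of_real power2_eq_square)
    qed
    show "(*\<^sub>R) (inverse (norm x)) ` duality_set smul x \<subseteq> ?S"
      using assms
      by (auto simp: duality_set_def scaleR_in_dual_space blinfun.scaleR_left blinfun.scaleR_right
          scaleR_conv_of_real power2_eq_square field_simps)
  qed (use assms in simp_all)
  then have "card ?S = card (duality_set smul x)"
    by (rule bij_betw_same_card)
  moreover have "(\<exists>!f. f \<in> A) \<longleftrightarrow> card A = Suc 0" for A :: "('a \<Rightarrow>\<^sub>L 'k) set"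
    unfolding card_1_singleton_iff by blast
  ultimately have "(\<exists>!f. f \<in> ?S) \<longleftrightarrow> (\<exists>!f. f \<in> duality_set smul x)"
    by (simp only:)
  then show ?thesis
    using assms by (simp add: smooth_points_def)
qed

text \<open>
  Expanding the product gives \<open>\<parallel>x\<parallel>\<^sup>2 + \<parallel>u\<parallel>\<^sup>2\<close> minus two mixed terms, each at most \<open>\<parallel>x\<parallel> \<parallel>u\<parallel>\<close>, hence a
  value of at least \<open>(\<parallel>x\<parallel> - \<parallel>u\<parallel>)\<^sup>2\<close>.
\<close>

lemma duality_set_monotone:
  fixes re :: "'k::real_or_complex \<Rightarrow> real"
  assumes "bounded_linear re" "re 1 = 1" "\<And>z. \<bar>re z\<bar> \<le> norm z"
    and "f \<in> duality_set smul x" "g \<in> duality_set smul u"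
  shows "0 \<le> re (blinfun_apply (f - g) (x - u))"
proof -
  interpret re: bounded_linear re by fact
  have re_of_real: "re (of_real r) = r" for r
    by (simp add: of_real_def re.scaleR assms(2))
  have bound: "re (blinfun_apply k v) \<le> norm k * norm v" for k :: "'a \<Rightarrow>\<^sub>L 'k" and v
    using assms(3)[of "blinfun_apply k v"] norm_blinfun[of k v] by linarith
  have "re (blinfun_apply (f - g) (x - u)) =
        (norm x)\<^sup>2 - re (blinfun_apply f u) - re (blinfun_apply g x) + (norm u)\<^sup>2"
    using assms(4,5) unfolding duality_set_def
    by (simp add: blinfun.diff_left blinfun.diff_right re.diff re_of_real del: of_real_power)
  moreover have "re (blinfun_apply f u) \<le> norm x * norm u" "re (blinfun_apply g x) \<le> norm u * norm x"
    using bound[of f u] bound[of g x] assms(4,5) unfolding duality_set_def by simp_all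
  moreover have "0 \<le> (norm x - norm u)\<^sup>2" by simp
  ultimately show ?thesis
    by (simp add: power2_diff mult.commute)
qed

text \<open>
  Linearity and the bound by \<open>\<parallel>x\<parallel>\<close> pass to the pointwise limit. The value at \<open>x\<close> does so because
  \<open>T(u)(x)\<close> differs from \<open>T(u)(u) = \<parallel>u\<parallel>\<^sup>2\<close> by at most \<open>\<parallel>u\<parallel> \<parallel>u - x\<parallel>\<close>. Norms can drop in weak-star
  limits; here the value at \<open>x\<close> forces the norm of the limit up to \<open>\<parallel>x\<parallel>\<close>.
\<close>

lemma duality_set_limit:
  assumes "G \<noteq> bot" "G \<le> nhds x" "\<And>u. T u \<in> duality_set smul u"
    and lim: "\<And>y. ((\<lambda>u. blinfun_apply (T u) y) \<longlongrightarrow> g y) G"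
  obtains f where "f \<in> duality_set smul x" "blinfun_apply f = g"
proof -
  have T: "T u \<in> dual_space smul" "norm (T u) = norm u"
    "blinfun_apply (T u) u = of_real ((norm u)\<^sup>2)" for u
    using assms(3)[of u] by (simp_all add: duality_set_def)
  note unique = tendsto_unique[OF \<open>G \<noteq> bot\<close>]
  have id: "((\<lambda>u. u) \<longlongrightarrow> x) G"
    using \<open>G \<le> nhds x\<close> by (simp add: filterlim_def)
  have bound: "norm (g y) \<le> norm y * norm x" for y
  proof (rule tendsto_le[OF \<open>G \<noteq> bot\<close>])
    show "((\<lambda>u. norm y * norm u) \<longlongrightarrow> norm y * norm x) G"
      by (intro tendsto_intros id)
    show "((\<lambda>u. norm (blinfun_apply (T u) y)) \<longlongrightarrow> norm (g y)) G"
      by (intro tendsto_intros lim)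
    show "\<forall>\<^sub>F u in G. norm (blinfun_apply (T u) y) \<le> norm y * norm u"
    proof (intro always_eventually allI)
      show "norm (blinfun_apply (T u) y) \<le> norm y * norm u" for u
        using norm_blinfun[of "T u" y] by (simp add: T(2) mult.commute)
    qed
  qed
  have linear: "bounded_linear g"
  proof (rule bounded_linear_intro)
    show "g (y + z) = g y + g z" for y z
      by (rule unique[OF lim]) (use tendsto_add[OF lim[of y] lim[of z]] in \<open>simp add: blinfun.add_right\<close>)
    show "g (r *\<^sub>R y) = r *\<^sub>R g y" for r y
      by (rule unique[OF lim])
        (use tendsto_scaleR[OF tendsto_const lim[of y]] in \<open>simp add: blinfun.scaleR_right\<close>)
  qed (rule bound)
  define f where "f = Blinfun g"
  have f: "blinfun_apply f = g"
    unfolding f_def using linear by (rule bounded_linear_Blinfun_apply)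
  have "g (smul c y) = c * g y" for c y
    by (rule unique[OF lim])
      (use tendsto_mult_left[OF lim[of y]] T(1) in \<open>simp add: dual_space_def\<close>)
  then have "f \<in> dual_space smul"
    by (simp add: dual_space_def f)
  moreover have gx: "g x = of_real ((norm x)\<^sup>2)"
  proof -
    have "((\<lambda>u. norm u * norm (u - x)) \<longlongrightarrow> norm x * norm (x - x)) G"
      by (intro tendsto_intros id)
    then have null: "((\<lambda>u. norm u * norm (u - x)) \<longlongrightarrow> 0) G"
      by simp
    have "\<forall>u. norm (blinfun_apply (T u) (u - x)) \<le> norm u * norm (u - x)"
      using norm_blinfun T(2) by metis
    then have "((\<lambda>u. blinfun_apply (T u) (u - x)) \<longlongrightarrow> 0) G"
      by (rule Lim_null_comparison[OF always_eventually null])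
    moreover have "((\<lambda>u. of_real ((norm u)\<^sup>2)) \<longlongrightarrow> (of_real ((norm x)\<^sup>2) :: 'b)) G"
      by (intro tendsto_intros id)
    ultimately have "((\<lambda>u. of_real ((norm u)\<^sup>2) - blinfun_apply (T u) (u - x)) \<longlongrightarrow>
        of_real ((norm x)\<^sup>2) - 0) G"
      by (intro tendsto_diff)
    then have "((\<lambda>u. blinfun_apply (T u) x) \<longlongrightarrow> of_real ((norm x)\<^sup>2)) G"
      by (simp add: blinfun.diff_right T(3))
    then show ?thesis by (rule unique[OF lim])
  qed
  moreover have "norm f = norm x"
  proof (rule antisym)
    show "norm f \<le> norm x"
    proof (rule norm_blinfun_bound)
      show "norm (blinfun_apply f y) \<le> norm x * norm y" for y
        using bound[of y] by (simp only: f mult.commute)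
    qed simp
    show "norm x \<le> norm f"
    proof (cases "x = 0")
      case False
      have "norm x * norm x \<le> norm f * norm x"
        using norm_blinfun[of f x] unfolding f gx by (simp add: norm_mult power2_eq_square)
      with False show ?thesis by simp
    qed simp
  qed
  ultimately show thesis
    using that[of f] by (simp add: duality_set_def f)
qed

section \<open>The equivalence\<close>

text \<open>
  Continuity is used only along the rays from \<open>x\<close>, where monotonicity fixes the sign of the real
  part of \<open>f - T(x + t y)\<close> at \<open>y\<close>.
\<close>

lemma weak_star_continuous_imp_duality_set_singleton:
  fixes T :: "'a::banach \<Rightarrow> 'a \<Rightarrow>\<^sub>L 'k::real_or_complex"
  assumes T: "\<And>u. T u \<in> duality_set smul u"
    and lim: "\<And>y. ((\<lambda>u. blinfun_apply (T u) y) \<longlongrightarrow> blinfun_apply (T x) y) (nhds x)"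
    and f: "f \<in> duality_set smul x"
  shows "f = T x"
proof -
  obtain re :: "'k \<Rightarrow> real" where re: "bounded_linear re" "re 1 = 1" "\<And>z. \<bar>re z\<bar> \<le> norm z"
    using scalar_real_part by blast
  interpret re: bounded_linear re by (rule re(1))
  have le: "re (blinfun_apply (f - T x) y) \<le> 0" for y
  proof (rule tendsto_upperbound)
    have "((\<lambda>t. x + t *\<^sub>R y) \<longlongrightarrow> x + 0 *\<^sub>R y) (at_right 0)"
      by (intro tendsto_intros)
    then have "filterlim (\<lambda>t. x + t *\<^sub>R y) (nhds x) (at_right 0)" by simp
    then show "((\<lambda>t. re (blinfun_apply (f - T (x + t *\<^sub>R y)) y)) \<longlongrightarrow>
        re (blinfun_apply (f - T x) y)) (at_right 0)"
      unfolding blinfun.diff_left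
      by (intro re.tendsto tendsto_diff tendsto_const filterlim_compose[OF lim])
    have "re (blinfun_apply (f - T (x + t *\<^sub>R y)) y) \<le> 0" if "0 < t" for t
    proof -
      have "0 \<le> re (blinfun_apply (f - T (x + t *\<^sub>R y)) (x - (x + t *\<^sub>R y)))"
        by (rule duality_set_monotone[OF re f T])
      then have "t * re (blinfun_apply (f - T (x + t *\<^sub>R y)) y) \<le> 0"
        by (simp add: blinfun.minus_right blinfun.scaleR_right re.neg re.scaleR)
      with that show ?thesis by (simp add: mult_le_0_iff)
    qed
    then show "\<forall>\<^sub>F t in at_right 0. re (blinfun_apply (f - T (x + t *\<^sub>R y)) y) \<le> 0"
      by (auto simp: eventually_at_right_less intro: eventually_at_rightI[of 0 1])
  qed simp
  show ?thesis
  proof (rule blinfun_eqI, rule ccontr)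
    fix y assume "blinfun_apply f y \<noteq> blinfun_apply (T x) y"
    then have nz: "blinfun_apply (f - T x) y \<noteq> 0" by (simp add: blinfun.diff_left)
    \<comment> \<open>Rescaling \<open>y\<close> by a scalar makes the value equal to \<open>1\<close>, whose real part is positive.\<close>
    have "f - T x \<in> dual_space smul"
      using f T[of x] by (simp add: duality_set_def dual_space_def blinfun.diff_left algebra_simps)
    then have "blinfun_apply (f - T x) (smul (inverse (blinfun_apply (f - T x) y)) y) = 1"
      using nz by (simp add: dual_space_def)
    with le re(2) show False by (metis not_one_le_zero)
  qed
qed

text \<open>
  By compactness and closedness, a failure of continuity at \<open>x\<close> produces an element of the duality
  set that differs from \<open>T(x)\<close> at \<open>y\<close>.
\<close>

lemma duality_set_singleton_imp_weak_star_continuous: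
  fixes T :: "'a::banach \<Rightarrow> 'a \<Rightarrow>\<^sub>L 'k::real_or_complex"
  assumes T: "\<And>u. T u \<in> duality_set smul u"
    and unique: "\<And>f. f \<in> duality_set smul x \<Longrightarrow> f = T x"
  shows "((\<lambda>u. blinfun_apply (T u) y) \<longlongrightarrow> blinfun_apply (T x) y) (nhds x)"
proof (rule ccontr)
  assume "\<not> ?thesis"
  then obtain S where S: "open S" "blinfun_apply (T x) y \<in> S"
    "\<not> (\<forall>\<^sub>F u in nhds x. blinfun_apply (T u) y \<in> S)"
    unfolding tendsto_def by blast
  define F where "F = inf (nhds x) (principal {u. blinfun_apply (T u) y \<notin> S})"
  have "F \<noteq> bot"
    using S(3) by (simp add: F_def trivial_limit_def eventually_inf_principal)
  \<comment> \<open>The margin \<open>1\<close> is there because \<open>T(u)\<close> may have norm above \<open>\<parallel>x\<parallel>\<close> for \<open>u\<close> close to \<open>x\<close>.\<close>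
  define K where "K = (\<Pi>\<^sub>E z\<in>UNIV. cball (0::'k) ((norm x + 1) * norm (z::'a)))"
  have "compactin (product_topology (\<lambda>_. euclidean) UNIV) K"
    unfolding K_def compactin_PiE by (simp add: scalar_compact_cball)
  then have "compact K"
    by (simp add: euclidean_product_topology)
  have eventually_K: "\<forall>\<^sub>F u in F. blinfun_apply (T u) \<in> K"
  proof -
    have "\<forall>\<^sub>F u in nhds x. norm u < norm x + 1"
      by (rule order_tendstoD(2)[OF tendsto_norm[OF filterlim_ident]]) simp
    then have "\<forall>\<^sub>F u in nhds x. blinfun_apply (T u) \<in> K"
    proof eventually_elim
      case (elim u)
      have "norm (blinfun_apply (T u) z) \<le> (norm x + 1) * norm z" for z
      proof -
        have "norm (blinfun_apply (T u) z) \<le> norm u * norm z"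
          using norm_blinfun[of "T u" z] T[of u] by (simp add: duality_set_def)
        also have "\<dots> \<le> (norm x + 1) * norm z"
          using elim by (intro mult_right_mono) auto
        finally show ?thesis .
      qed
      then show ?case by (simp add: K_def PiE_UNIV_domain)
    qed
    then show ?thesis
      unfolding F_def by (rule filter_leD[OF inf_le1])
  qed
  obtain g G where G: "G \<le> F" "G \<noteq> bot" "((\<lambda>u. blinfun_apply (T u)) \<longlongrightarrow> g) G"
    by (rule compact_convergent_subfilter[OF \<open>compact K\<close> \<open>F \<noteq> bot\<close> eventually_K])
  have "G \<le> nhds x"
    using G(1) by (simp add: F_def)
  have lim: "((\<lambda>u. blinfun_apply (T u) z) \<longlongrightarrow> g z) G" for z
    using G(3) by (simp add: tendsto_fun_iff)
  obtain f where "f \<in> duality_set smul x" "blinfun_apply f = g"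
    using duality_set_limit[OF \<open>G \<noteq> bot\<close> \<open>G \<le> nhds x\<close> T lim] by blast
  with unique have "g y = blinfun_apply (T x) y" by blast
  with lim[of y] S(1,2) have "\<forall>\<^sub>F u in G. blinfun_apply (T u) y \<in> S"
    by (simp add: topological_tendstoD)
  moreover have "\<forall>\<^sub>F u in G. blinfun_apply (T u) y \<notin> S"
    using G(1) by (rule filter_leD) (simp add: F_def eventually_inf_principal)
  ultimately have "\<forall>\<^sub>F u in G. False"
    by eventually_elim blast
  with G(2) show False by simp
qed

theorem theorem3p6:
  fixes smul :: "'k::real_or_complex \<Rightarrow> 'a::banach \<Rightarrow> 'a"
    and T :: "'a \<Rightarrow> 'a \<Rightarrow>\<^sub>L 'k"
    and x :: 'a
  assumes "banach_space_over smul"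
    and "dual_map smul T"
    and "x \<noteq> 0"
  shows "topcontinuous_at euclidean (weak_star_topology smul) T x \<longleftrightarrow>
         x /\<^sub>R norm x \<in> smooth_points smul"
proof -
  have T: "T u \<in> duality_set smul u" for u
    using assms(2) by (simp add: dual_map_iff_duality_set)
  then have "T u \<in> dual_space smul" for u
    by (simp add: duality_set_def)
  then have "topcontinuous_at euclidean (weak_star_topology smul) T x \<longleftrightarrow>
      (\<forall>y. ((\<lambda>u. T u y) \<longlongrightarrow> T x y) (nhds x))"
    by (rule topcontinuous_at_weak_star_iff)
  also have "\<dots> \<longleftrightarrow> (\<forall>f. f \<in> duality_set smul x \<longrightarrow> f = T x)"
    using weak_star_continuous_imp_duality_set_singleton[of T smul x]
      duality_set_singleton_imp_weak_star_continuous[of T smul x] T by blast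
  also have "\<dots> \<longleftrightarrow> (\<exists>!f. f \<in> duality_set smul x)"
    using T by blast
  also have "\<dots> \<longleftrightarrow> x /\<^sub>R norm x \<in> smooth_points smul"
    using smooth_point_iff_duality_set_singleton[OF assms(3)] by blast
  finally show ?thesis .
qed

end
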